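(* Let $T\colon [0,1) \to [0,1)$ be a measurable map which preserves the Lebesgue measure $\mu$ on $[0,1)$. Then $r(T,x) \leq \frac{1}{\sqrt{5}}$ for $\mu$-almost every $x \in [0,1)$, where $r(T,x) = \liminf_{n \to \infty} n\,|T^n x - x|$.
   Context: For a measurable map $T\colon[0,1)\to[0,1)$ and $x\in[0,1)$, the recurrence rate of $T$ at $x$ is $r(T,x) = \liminf_{n\to\infty} n\,|T^n x - x| \in [0,\infty]$. The map $T$ preserves $\mu$ if $\mu(T^{-1}(A))=\mu(A)$ for every measurable $A\subset[0,1)$ ($T$ is not assumed invertible). *)

theory Defs
  imports "HOL-Analysis.Analysis"
begin

(* Lebesgue (not merely Borel) measurable sets; the Borel case is an instance, because
   a measure-preserving Borel map is also Lebesgue-Lebesgue measurable and measure-preserving. *)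
abbreviation unit_lebesgue :: "real measure" where
  "unit_lebesgue \<equiv> lebesgue_on {0..<1}"

(* Measurability of T already includes that T maps the space of M into itself. *)
definition measure_preserving_map :: "'a measure \<Rightarrow> ('a \<Rightarrow> 'a) \<Rightarrow> bool" where
  "measure_preserving_map M T \<longleftrightarrow>
     T \<in> measurable M M \<and> (\<forall>A \<in> sets M. emeasure M (T -` A \<inter> space M) = emeasure M A)"

definition recurrence_rate :: "(real \<Rightarrow> real) \<Rightarrow> real \<Rightarrow> ereal" where
  "recurrence_rate T x = liminf (\<lambda>n. ereal (real n * \<bar>(T ^^ n) x - x\<bar>))"

end

(*
  Suppose that on a set of positive measure |T^n x - x| >= min (c/n) d for all n >= 1, where
  c > 1/sqrt 5. Near a density point pick an interval of length L < d that this set almost fills;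
  by averaging, some orbit visits it at a proportion of almost L of the times n < h.
  The points (T^n x, n) of these visits lie in a rectangle of area L h, and any two of them satisfy
  |dx| |dn| >= c. A triangle with such vertices has area at least c sqrt 5 / 2, as in Hurwitz's
  theorem, unless its vertices form a monotone chain.
  Join the points inserted so far, sorted by position, to a polygonal front. Inserting the points in
  order of time, and then removing them in order of time, moves the front across the rectangle; every
  step sweeps out a triangle whose middle vertex in position is extreme in time, hence a non-monotone
  one. So there are at most L h / (c sqrt 5) points, up to the O(sqrt h) points inserted or removed
  at an end of the front, which contradicts the number of visits as h tends to infinity.
*)
theory Submission
  imports Defs
begin


section \<open>Fronts, triangles and separated point sets\<close>

text \<open>Points are pairs (position, time). The front is the graph of time over position.\<close>

fun front_area :: "(real \<times> real) list \<Rightarrow> real" where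
  "front_area (p # q # ps) = (fst q - fst p) * (snd p + snd q) / 2 + front_area (q # ps)"
| "front_area _ = 0"

text \<open>The area of the triangle \<open>p\<close>, \<open>v\<close>, \<open>q\<close>, signed to
  be positive, for \<open>fst p < fst q\<close>, when \<open>v\<close> lies above the line through
  \<open>p\<close> and \<open>q\<close>. In this form both products are nonnegative when
  \<open>v\<close> is between the others in position and the latest of the three.\<close>

definition triangle_gain :: "real \<times> real \<Rightarrow> real \<times> real \<Rightarrow> real \<times> real \<Rightarrow> real" where
  "triangle_gain p v q =
     ((fst v - fst p) * (snd v - snd q) + (fst q - fst v) * (snd v - snd p)) / 2"

definition separated :: "real \<Rightarrow> (real \<times> real) set \<Rightarrow> bool" where
  "separated c P \<longleftrightarrow>
     (\<forall>p\<in>P. \<forall>q\<in>P. p \<noteq> q \<longrightarrow> c \<le> \<bar>fst p - fst q\<bar> * \<bar>snd p - snd q\<bar>)"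

text \<open>The records are the points inserted next to an end of the front, where the triangles may be
  small.\<close>

definition left_records :: "(real \<times> real) set \<Rightarrow> (real \<times> real) set" where
  "left_records P = {v \<in> P. \<forall>u\<in>P. fst u < fst v \<longrightarrow> snd v < snd u}"

definition right_records :: "(real \<times> real) set \<Rightarrow> (real \<times> real) set" where
  "right_records P = {v \<in> P. \<forall>u\<in>P. fst v < fst u \<longrightarrow> snd v < snd u}"

definition reflect_time :: "real \<Rightarrow> real \<times> real \<Rightarrow> real \<times> real" where
  "reflect_time h p = (fst p, h - snd p)"

lemma separated_subset: "separated c P \<Longrightarrow> Q \<subseteq> P \<Longrightarrow> separated c Q"
  unfolding separated_def by blast

lemma separated_fst_neq:
  "separated c P \<Longrightarrow> 0 < c \<Longrightarrow> p \<in> P \<Longrightarrow> q \<in> P \<Longrightarrow> p \<noteq> q \<Longrightarrow> fst p \<noteq> fst q"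
  unfolding separated_def by fastforce

lemma separated_snd_neq:
  "separated c P \<Longrightarrow> 0 < c \<Longrightarrow> p \<in> P \<Longrightarrow> q \<in> P \<Longrightarrow> p \<noteq> q \<Longrightarrow> snd p \<noteq> snd q"
  unfolding separated_def by fastforce

lemma front_area_insert:
  "front_area (ps @ p # v # q # qs) = front_area (ps @ p # q # qs) + triangle_gain p v q"
proof (induction ps)
  case Nil
  show ?case by (simp add: triangle_gain_def field_simps)
next
  case (Cons r ps)
  then show ?case by (cases ps) simp_all
qed

text \<open>Each trapezoid and its reflection add up to a box of height \<open>h\<close>.\<close>

lemma front_area_reflect:
  "front_area (map (reflect_time h) (p # ps)) = h * (fst (last (p # ps)) - fst p) - front_area (p # ps)"
proof (induction ps arbitrary: p)
  case Nil
  show ?case by simp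
next
  case (Cons q ps)
  show ?case using Cons[of q] by (simp add: reflect_time_def field_simps)
qed

text \<open>Serves to raise the two ends of a front from time 0 to time \<open>h\<close>.\<close>

lemma front_area_mono:
  assumes "list_all2 (\<lambda>p q. fst p = fst q \<and> snd p \<le> snd q) ps qs"
    and "sorted (map fst ps)"
  shows "front_area ps \<le> front_area qs"
  using assms
proof (induction ps qs rule: list_all2_induct)
  case Nil
  show ?case by simp
next
  case (Cons p ps q qs)
  show ?case
  proof (cases ps)
    case Nil
    then show ?thesis using Cons by simp
  next
    case c: (Cons p' ps')
    then obtain q' qs' where q: "qs = q' # qs'" "fst p' = fst q'" "snd p' \<le> snd q'"
      using Cons by (auto simp: list_all2_Cons1)
    have "(fst p' - fst p) * (snd p + snd p') \<le> (fst p' - fst p) * (snd q + snd q')"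
      using Cons c q by (intro mult_left_mono add_mono) auto
    then show ?thesis using Cons c q by auto
  qed
qed

section \<open>Hurwitz's bound for a triangle\<close>

text \<open>The form p X^2 + s X Y - q Y^2 has values at least \<open>c\<close>, at most
  \<open>-c\<close> and at least \<open>c\<close> at (1,0), (0,1) and (1,1); the conclusion bounds
  its discriminant. Equality at p = q = s = c is the golden ratio form behind Hurwitz's
  constant.\<close>

lemma discriminant_ge:
  fixes c p q s :: real
  assumes "0 < c" "c \<le> p" "c \<le> q" "c \<le> p + s - q"
  shows "5 * c\<^sup>2 \<le> s\<^sup>2 + 4 * p * q"
\<comment> \<open>First case: \<open>s\<close> is at least \<open>c + q - p\<close>, which is
  nonnegative and so can be squared. Second case: \<open>p\<close> exceeds \<open>2 * c\<close>, and
  the product term alone suffices.\<close>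
proof (cases "p - q \<le> c")
  case True
  have "(c + q - p)\<^sup>2 \<le> s\<^sup>2"
    using True assms by (intro power_mono) auto
  moreover have "(c + q - p)\<^sup>2 + 4 * p * q - 5 * c\<^sup>2 = (p - c) * (p - c + 2 * q) + (q - c) * (q + 5 * c)"
    by (simp add: power2_eq_square algebra_simps)
  moreover have "0 \<le> (p - c) * (p - c + 2 * q)" "0 \<le> (q - c) * (q + 5 * c)"
    using assms by auto
  ultimately show ?thesis by linarith
next
  case False
  have "(2 * c) * c \<le> p * q" using False assms by (intro mult_mono) auto
  then have "8 * c\<^sup>2 \<le> 4 * p * q" by (simp add: power2_eq_square)
  moreover have "0 \<le> s\<^sup>2" "0 \<le> c\<^sup>2" by auto
  ultimately show ?thesis by linarith
qed

text \<open>\<open>w\<close>, \<open>x\<close> are the differences in position and time between the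
  middle vertex and its left neighbour, \<open>y\<close>, \<open>z\<close> those for the right
  neighbour. The right-hand side is twice the area, and its square is the discriminant for
  \<open>p = w * x\<close>, \<open>q = y * z\<close>, \<open>s = y * x - w * z\<close>.\<close>

lemma non_monotone_triangle:
  fixes w x y z c :: real
  assumes c: "0 < c" and pos: "0 < w" "0 < x" "0 < y" "0 < z"
    and sep: "c \<le> w * x" "c \<le> y * z" "c \<le> (w + y) * \<bar>x - z\<bar>"
  shows "sqrt 5 * c \<le> w * z + y * x"
proof -
  let ?s = "y * x - w * z"
  have "5 * c\<^sup>2 \<le> ?s\<^sup>2 + 4 * (w * x) * (y * z)"
  \<comment> \<open>\<open>(w + y) * (x - z)\<close> equals \<open>w * x + ?s - y * z\<close>. When
    it is negative, the form is negated, which swaps the two products.\<close>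
  proof (cases "z \<le> x")
    case True
    then have "c \<le> w * x + ?s - y * z" using sep(3) by (simp add: algebra_simps)
    then show ?thesis using discriminant_ge[OF c sep(1,2)] by simp
  next
    case False
    then have "c \<le> y * z + (- ?s) - w * x" using sep(3) by (simp add: algebra_simps)
    then show ?thesis using discriminant_ge[OF c sep(2,1), of "- ?s"]
      by (simp add: algebra_simps power2_eq_square)
  qed
  also have "\<dots> = (w * z + y * x)\<^sup>2" by (simp add: power2_eq_square algebra_simps)
  finally have "sqrt (5 * c\<^sup>2) \<le> w * z + y * x"
    using pos by (intro real_le_lsqrt) auto
  then show ?thesis using c by (simp add: real_sqrt_mult)
qed

section \<open>Area swept out by insertions\<close>

text \<open>The induction undoes the last insertion. The latest point \<open>v\<close> is later than
  both its neighbours in the front, so its triangle is non-monotone. The area bound can fail only if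
  a neighbour is an end of the front, where separation is not assumed; then \<open>v\<close> is a
  record.\<close>

lemma front_area_ge:
  assumes c: "0 < c"
    and "sorted_wrt (\<lambda>p q. fst p < fst q) ps"
    and "separated c (set ps)"
    and "\<forall>p\<in>set ps. a \<le> fst p \<and> fst p \<le> b \<and> 0 \<le> snd p"
  shows "sqrt 5 * c / 2 * (real (length ps) - card (left_records (set ps) \<union> right_records (set ps)))
    \<le> front_area ((a, 0) # ps @ [(b, 0)])"
  using assms(2-)
proof (induction "length ps" arbitrary: ps)
  case 0
  then show ?case by (simp add: left_records_def right_records_def)
next
  case (Suc n)
  note srt = Suc.prems(1) and sep = Suc.prems(2) and box = Suc.prems(3)
  let ?bad = "\<lambda>P. left_records P \<union> right_records P"
  have "ps \<noteq> []" using Suc.hyps(2) by auto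
  then obtain v where v: "v \<in> set ps" and vmax: "\<forall>u\<in>set ps. snd u \<le> snd v"
  proof -
    have "Max (snd ` set ps) \<in> snd ` set ps" using \<open>ps \<noteq> []\<close> by (intro Max_in) auto
    then obtain v where "v \<in> set ps" "snd v = Max (snd ` set ps)" by force
    then show ?thesis using that by simp
  qed
  obtain us ws where ps: "ps = us @ v # ws" using v by (meson split_list)
  define qs where "qs = us @ ws"
  have us: "\<forall>u\<in>set us. fst u < fst v" and ws: "\<forall>u\<in>set ws. fst v < fst u"
    using srt by (auto simp: ps sorted_wrt_append)
  have sub: "set ps = insert v (set qs)" and vn: "v \<notin> set qs"
    using us ws by (auto simp: ps qs_def)
  have vlt: "snd u < snd v" if "u \<in> set qs" for u
    using that vmax separated_snd_neq[OF sep c, of u v] sub vn v by fastforce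
  have IH: "sqrt 5 * c / 2 * (real (length qs) - card (?bad (set qs)))
      \<le> front_area ((a, 0) # qs @ [(b, 0)])"
  proof (rule Suc.hyps(1))
    show "n = length qs" using Suc.hyps(2) by (simp add: ps qs_def)
    show "sorted_wrt (\<lambda>p q. fst p < fst q) qs"
      using srt by (auto simp: ps qs_def sorted_wrt_append)
    show "separated c (set qs)" using sep sub by (auto intro: separated_subset)
    show "\<forall>p\<in>set qs. a \<le> fst p \<and> fst p \<le> b \<and> 0 \<le> snd p" using box sub by auto
  qed
  \<comment> \<open>A record needs all points on one side to be later. As \<open>v\<close> is later
    than every point of \<open>qs\<close>, adding it destroys no record.\<close>
  have bad_sub: "?bad (set qs) \<subseteq> ?bad (set ps) - {v}"
    using vlt vn unfolding left_records_def right_records_def sub by auto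
  have fin: "finite (?bad (set ps))" by (auto simp: left_records_def right_records_def)
  obtain rs p where rp: "(a, 0) # us = rs @ [p]" by (metis list.discI rev_exhaust)
  obtain q ss where qs': "ws @ [(b, 0)] = q # ss" by (metis append_is_Nil_conv list.exhaust not_Cons_self2)
  have eq1: "(a, 0) # ps @ [(b, 0)] = rs @ p # v # q # ss"
    using rp qs' unfolding ps by (metis append.assoc append_Cons append_Nil)
  have eq2: "(a, 0) # qs @ [(b, 0)] = rs @ p # q # ss"
    using rp qs' unfolding qs_def by (metis append.assoc append_Cons append_Nil)
  have area: "front_area ((a, 0) # ps @ [(b, 0)]) = front_area ((a, 0) # qs @ [(b, 0)]) + triangle_gain p v q"
    unfolding eq1 eq2 by (rule front_area_insert)
  have p_in: "p = (a, 0) \<or> p \<in> set us"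
    using arg_cong[OF rp, of set] by auto
  have q_in: "q = (b, 0) \<or> q \<in> set ws"
    using arg_cong[OF qs', of set] by auto
  have pv: "fst p \<le> fst v" "snd p \<le> snd v" and qv: "fst v \<le> fst q" "snd q \<le> snd v"
    using p_in q_in us ws box v vmax by (auto simp: ps less_imp_le)
  have gain0: "0 \<le> triangle_gain p v q"
    using pv qv by (auto simp: triangle_gain_def)
  have len: "real (length ps) = real (length qs) + 1" by (simp add: ps qs_def)
  show ?case
  \<comment> \<open>For a record the claimed bound does not grow, so a nonnegative gain is enough;
    any other point must gain \<open>sqrt 5 * c / 2\<close>.\<close>
  proof (cases "v \<in> ?bad (set ps)")
    case True
    have "card (?bad (set qs)) \<le> card (?bad (set ps) - {v})"
      using bad_sub fin by (intro card_mono) auto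
    also have "\<dots> = card (?bad (set ps)) - 1" using True by simp
    finally have "card (?bad (set qs)) + 1 \<le> card (?bad (set ps))"
      using True fin card_gt_0_iff[of "?bad (set ps)"] by fastforce
    then have "real (length ps) - card (?bad (set ps)) \<le> real (length qs) - card (?bad (set qs))"
      using len by linarith
    then have "sqrt 5 * c / 2 * (real (length ps) - card (?bad (set ps)))
        \<le> sqrt 5 * c / 2 * (real (length qs) - card (?bad (set qs)))"
      using c by (intro mult_left_mono) auto
    then show ?thesis using IH area gain0 by linarith
  next
    case False
    \<comment> \<open>Without points to its left, \<open>v\<close> would vacuously be a left record;
      similarly on the right.\<close>
    have "us \<noteq> []"
      using False ws v by (auto simp: left_records_def ps)
    then have p: "p \<in> set us" using rp by (cases us rule: rev_cases) auto
    have "ws \<noteq> []"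
      using False us v by (auto simp: right_records_def ps)
    then have q: "q \<in> set ws" using qs' by (cases ws) auto
    have pq: "fst p < fst v" "fst v < fst q" "snd p < snd v" "snd q < snd v"
      using p q us ws vlt by (auto simp: qs_def)
    have "sqrt 5 * c \<le> (fst v - fst p) * (snd v - snd q) + (fst q - fst v) * (snd v - snd p)"
    proof (rule non_monotone_triangle[OF c])
      have s: "c \<le> \<bar>fst x - fst y\<bar> * \<bar>snd x - snd y\<bar>" if "x \<in> set ps" "y \<in> set ps" "x \<noteq> y" for x y
        using sep that by (auto simp: separated_def)
      show "c \<le> (fst v - fst p) * (snd v - snd p)" using s[of v p] p pq by (auto simp: ps)
      show "c \<le> (fst q - fst v) * (snd v - snd q)" using s[of q v] q pq by (auto simp: ps)
      show "c \<le> (fst v - fst p + (fst q - fst v)) * \<bar>snd v - snd p - (snd v - snd q)\<bar>"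
      proof -
        have "q \<noteq> p" using pq by auto
        then have "c \<le> \<bar>fst q - fst p\<bar> * \<bar>snd q - snd p\<bar>" using s p q by (simp add: ps)
        then show ?thesis using pq by simp
      qed
    qed (use pq in auto)
    then have gain: "sqrt 5 * c / 2 \<le> triangle_gain p v q" by (simp add: triangle_gain_def)
    have "card (?bad (set qs)) \<le> card (?bad (set ps))"
      using bad_sub fin by (intro card_mono) auto
    then have "real (length ps) - card (?bad (set ps)) \<le> real (length qs) - card (?bad (set qs)) + 1"
      using len by linarith
    then have "sqrt 5 * c / 2 * (real (length ps) - card (?bad (set ps)))
        \<le> sqrt 5 * c / 2 * (real (length qs) - card (?bad (set qs)) + 1)"
      using c by (intro mult_left_mono) auto
    then show ?thesis using IH area gain unfolding distrib_left mult_1_right by linarith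
  qed
qed

section \<open>Counting records\<close>

text \<open>Pigeonhole: each half-open cell of length \<open>g\<close> holds at most one
  point.\<close>

lemma card_le_of_gaps:
  fixes S :: "real set"
  assumes "S \<subseteq> {l..l + d}" "0 \<le> d" "0 < g"
    and gap: "\<And>x y. x \<in> S \<Longrightarrow> y \<in> S \<Longrightarrow> x \<noteq> y \<Longrightarrow> g \<le> \<bar>x - y\<bar>"
  shows "real (card S) \<le> d / g + 1"
proof -
  let ?f = "\<lambda>x. nat \<lfloor>(x - l) / g\<rfloor>"
  have in_range: "l \<le> x" "x - l \<le> d" if "x \<in> S" for x
    using that assms(1) by (auto simp: subset_iff)
  have "inj_on ?f S"
  proof (rule inj_onI, rule ccontr)
    fix x y assume xy: "x \<in> S" "y \<in> S" "?f x = ?f y" "x \<noteq> y"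
    have "0 \<le> (x - l) / g" "0 \<le> (y - l) / g"
      using in_range xy(1,2) \<open>0 < g\<close> by simp_all
    then have "\<lfloor>(x - l) / g\<rfloor> = \<lfloor>(y - l) / g\<rfloor>"
      using xy(3) by (simp add: eq_nat_nat_iff)
    then have "\<bar>(x - l) / g - (y - l) / g\<bar> < 1" by linarith
    moreover have "(x - l) / g - (y - l) / g = (x - y) / g" by (simp add: diff_divide_distrib)
    ultimately have "\<bar>x - y\<bar> < g" using \<open>0 < g\<close> by (simp add: abs_divide)
    then show False using gap[OF xy(1,2,4)] by linarith
  qed
  moreover have "?f ` S \<subseteq> {..nat \<lfloor>d / g\<rfloor>}"
  proof (clarsimp)
    fix x assume "x \<in> S"
    then show "nat \<lfloor>(x - l) / g\<rfloor> \<le> nat \<lfloor>d / g\<rfloor>"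
      using in_range \<open>0 < g\<close> by (intro nat_mono floor_mono divide_right_mono) auto
  qed
  ultimately have "card S \<le> card {..nat \<lfloor>d / g\<rfloor>}" using card_inj_on_le by blast
  moreover have "real (nat \<lfloor>d / g\<rfloor>) \<le> d / g" using \<open>0 \<le> d\<close> \<open>0 < g\<close> by simp
  ultimately show ?thesis by simp
qed

text \<open>The sign \<open>e\<close> treats chains rising in time (\<open>e = 1\<close>) and
  falling in time (\<open>e = - 1\<close>) together.\<close>

lemma card_monotone_chain_le:
  fixes e :: real
  assumes sep: "separated c R" and c: "0 < c" and h: "0 < h" and ab: "a \<le> b"
    and box: "R \<subseteq> {a..b} \<times> {0..h}"
    and e: "e = 1 \<or> e = - 1"
    and mono: "\<And>u v. u \<in> R \<Longrightarrow> v \<in> R \<Longrightarrow> fst u < fst v \<Longrightarrow> e * snd u < e * snd v"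
  shows "real (card R) \<le> 1 + (b - a + 1) * sqrt h / (2 * sqrt c)"
proof -
  \<comment> \<open>By AM-GM a lower bound on the product of the coordinate differences bounds their
    weighted sum from below; the weight 1/h makes the count O(sqrt h).\<close>
  define f where "f p = fst p + e * snd p / h" for p :: "real \<times> real"
  define g where "g = 2 * sqrt c / sqrt h"
  have g: "0 < g" using c h by (simp add: g_def)
  have gap': "g \<le> f v - f u" if uv: "u \<in> R" "v \<in> R" "fst u < fst v" for u v
  proof -
    define x where "x = fst v - fst u"
    define y where "y = (e * snd v - e * snd u) / h"
    have pos: "0 < x" "0 < y" using uv mono[OF uv] h by (auto simp: x_def y_def)
    have "y * h = \<bar>snd u - snd v\<bar>"
      using e mono[OF uv] h by (auto simp: y_def)
    moreover have "c \<le> \<bar>fst u - fst v\<bar> * \<bar>snd u - snd v\<bar>"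
      using sep uv unfolding separated_def by (metis less_irrefl)
    ultimately have "c \<le> x * (y * h)" using uv by (simp add: x_def)
    then have "c / h \<le> x * y" using h by (simp add: field_simps)
    then have "4 * (c / h) \<le> (x + y)\<^sup>2"
      using zero_le_power2[of "x - y"] unfolding power2_sum power2_diff by linarith
    moreover have "g\<^sup>2 = 4 * (c / h)" using c h by (simp add: g_def power_mult_distrib power_divide)
    ultimately have "g\<^sup>2 \<le> (x + y)\<^sup>2" by simp
    then have "g \<le> x + y" by (rule power2_le_imp_le) (use pos in simp)
    also have "x + y = f v - f u" unfolding x_def y_def f_def diff_divide_distrib by linarith
    finally show ?thesis .
  qed
  have gap: "g \<le> \<bar>f u - f v\<bar>" if uv: "u \<in> R" "v \<in> R" "u \<noteq> v" for u v
  proof -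
    have "fst u < fst v \<or> fst v < fst u"
      using separated_fst_neq[OF sep c uv] by linarith
    then show ?thesis
    proof
      assume "fst u < fst v"
      then show ?thesis using gap'[of u v] uv by linarith
    next
      assume "fst v < fst u"
      then show ?thesis using gap'[of v u] uv by linarith
    qed
  qed
  have inj: "inj_on f R"
  proof (rule inj_onI, rule ccontr)
    fix u v assume "u \<in> R" "v \<in> R" "f u = f v" "u \<noteq> v"
    then show False using gap[of u v] g by simp
  qed
  have "real (card (f ` R)) \<le> (b - a + 1) / g + 1"
  proof (rule card_le_of_gaps)
    \<comment> \<open>The time term lies in [0,1] or in [-1,0] according to \<open>e\<close>, hence
      the shift \<open>min 0 e\<close> and the extra length 1.\<close>
    show "f ` R \<subseteq> {a + min 0 e..a + min 0 e + (b - a + 1)}"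
    proof (clarify)
      fix p q assume "(p, q) \<in> R"
      then have "a \<le> p" "p \<le> b" "0 \<le> q / h" "q / h \<le> 1" using box h by auto
      then show "f (p, q) \<in> {a + min 0 e..a + min 0 e + (b - a + 1)}"
        using e by (auto simp: f_def)
    qed
    show "g \<le> \<bar>x - y\<bar>" if "x \<in> f ` R" "y \<in> f ` R" "x \<noteq> y" for x y
      using that gap by blast
  qed (use ab g in auto)
  then show ?thesis using inj by (simp add: card_image g_def)
qed

text \<open>From left to right the left records fall in time and the right records rise, so each
  kind is a chain.\<close>

lemma card_records_le:
  assumes "separated c P" "0 < c" "0 < h" "a \<le> b" "P \<subseteq> {a..b} \<times> {0..h}"
  shows "real (card (left_records P \<union> right_records P))
    \<le> 2 * (1 + (b - a + 1) * sqrt h / (2 * sqrt c))"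
proof -
  have sub: "left_records P \<subseteq> P" "right_records P \<subseteq> P"
    by (auto simp: left_records_def right_records_def)
  have "real (card (left_records P)) \<le> 1 + (b - a + 1) * sqrt h / (2 * sqrt c)"
    by (rule card_monotone_chain_le[where e = "- 1"])
       (use assms sub in \<open>auto intro: separated_subset simp: left_records_def\<close>)
  moreover have "real (card (right_records P)) \<le> 1 + (b - a + 1) * sqrt h / (2 * sqrt c)"
    by (rule card_monotone_chain_le[where e = 1])
       (use assms sub in \<open>auto intro: separated_subset simp: right_records_def\<close>)
  moreover have "real (card (left_records P \<union> right_records P))
      \<le> real (card (left_records P)) + real (card (right_records P))"
    by (metis card_Un_le of_nat_add of_nat_le_iff)
  ultimately show ?thesis unfolding mult_2 by linarith
qed

section \<open>Separated points in a rectangle\<close>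

lemma sorted_enumeration:
  fixes P :: "(real \<times> real) set"
  assumes "finite P" "inj_on fst P"
  obtains ps where "set ps = P" "length ps = card P" "sorted_wrt (\<lambda>p q. fst p < fst q) ps"
proof
  define g where "g = the_inv_into P fst"
  define ps where "ps = map g (sorted_list_of_set (fst ` P))"
  have g: "g (fst p) = p" if "p \<in> P" for p
    using that assms by (simp add: g_def the_inv_into_f_f)
  show "set ps = P" using assms g by (force simp: ps_def)
  show "length ps = card P" using assms by (simp add: ps_def card_image)
  have "sorted_wrt (<) (sorted_list_of_set (fst ` P))" by simp
  moreover have "fst (g x) = x" if "x \<in> fst ` P" for x using that g by force
  ultimately show "sorted_wrt (\<lambda>p q. fst p < fst q) ps"
    using assms unfolding ps_def sorted_wrt_map
    by (elim sorted_wrt_mono_rel[rotated]) simp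
qed

text \<open>Insertion and removal each sweep out \<open>sqrt 5 * c / 2\<close> per point, except for
  at most \<open>2 * r\<close> records, and together no more than the area of the rectangle.\<close>

lemma separated_card_le:
  assumes fin: "finite P" and sep: "separated c P" and c: "0 < c" and h: "0 < h" and ab: "a \<le> b"
    and box: "P \<subseteq> {a..b} \<times> {0..h}"
  shows "sqrt 5 * c * card P
    \<le> h * (b - a) + 2 * (sqrt 5 * c) * (1 + (b - a + 1) * sqrt h / (2 * sqrt c))"
proof -
  define r where "r = 1 + (b - a + 1) * sqrt h / (2 * sqrt c)"
  \<comment> \<open>Removing the points in order of time is inserting the reflected points in reverse order.\<close>
  define Q where "Q = reflect_time h ` P"
  have "inj_on fst P" using separated_fst_neq[OF sep c] by (meson inj_onI)
  then obtain ps where ps: "set ps = P" "length ps = card P" "sorted_wrt (\<lambda>p q. fst p < fst q) ps"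
    using sorted_enumeration[OF fin] by blast
  define qs where "qs = map (reflect_time h) ps"
  have Q: "set qs = Q" "finite Q" by (simp_all add: qs_def Q_def ps(1) fin)
  have sepQ: "separated c Q"
    unfolding separated_def Q_def
  proof (intro ballI impI; elim imageE)
    fix p q u v
    assume *: "p \<noteq> q" "p = reflect_time h u" "q = reflect_time h v" and uv: "u \<in> P" "v \<in> P"
    from * have "u \<noteq> v" by blast
    then have "c \<le> \<bar>fst u - fst v\<bar> * \<bar>snd u - snd v\<bar>"
      using sep[unfolded separated_def, rule_format, OF uv] by simp
    then show "c \<le> \<bar>fst p - fst q\<bar> * \<bar>snd p - snd q\<bar>"
      by (simp add: *(2,3) reflect_time_def abs_minus_commute)
  qed
  have boxQ: "Q \<subseteq> {a..b} \<times> {0..h}" using box by (auto simp: Q_def reflect_time_def)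
  have bound: "sqrt 5 * c / 2 * (real (card P) - 2 * r) \<le> front_area ((a, 0) # xs @ [(b, 0)])"
    if xs: "set xs = X" "length xs = card P" "sorted_wrt (\<lambda>p q. fst p < fst q) xs"
      and X: "finite X" "separated c X" "X \<subseteq> {a..b} \<times> {0..h}" for xs X
  proof -
    have "sqrt 5 * c / 2 * (real (card P) - 2 * r)
        \<le> sqrt 5 * c / 2 * (real (length xs) - card (left_records (set xs) \<union> right_records (set xs)))"
      using c card_records_le[OF X(2) c h ab X(3)] xs
      by (intro mult_left_mono) (auto simp: r_def)
    also have "\<dots> \<le> front_area ((a, 0) # xs @ [(b, 0)])"
      by (rule front_area_ge[OF c]) (use xs X in auto)
    finally show ?thesis .
  qed
  have 1: "sqrt 5 * c / 2 * (real (card P) - 2 * r) \<le> front_area ((a, 0) # ps @ [(b, 0)])"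
    by (rule bound) (use ps fin sep box in auto)
  have 2: "sqrt 5 * c / 2 * (real (card P) - 2 * r) \<le> front_area ((a, 0) # qs @ [(b, 0)])"
    by (rule bound[OF _ _ _ Q(2) sepQ boxQ])
      (use Q ps in \<open>auto simp: qs_def sorted_wrt_map reflect_time_def\<close>)
  have "map (reflect_time h) ((a, h) # ps @ [(b, h)]) = (a, 0) # qs @ [(b, 0)]"
    by (simp add: qs_def reflect_time_def)
  then have 3: "front_area ((a, 0) # qs @ [(b, 0)]) = h * (b - a) - front_area ((a, h) # ps @ [(b, h)])"
    using front_area_reflect[of h "(a, h)" "ps @ [(b, h)]"] by simp
  \<comment> \<open>The removal pass sweeps the area above the front whose ends are at time
    \<open>h\<close>. It does not overlap the area below the front with ends at time 0, since
    raising the ends only raises the front.\<close>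
  have "front_area ((a, 0) # ps @ [(b, 0)]) \<le> front_area ((a, h) # ps @ [(b, h)])"
  proof (rule front_area_mono)
    have "sorted (map fst ps)"
      using ps(3) by (auto simp: sorted_map intro: sorted_wrt_mono_rel[rotated] less_imp_le)
    then show "sorted (map fst ((a, 0) # ps @ [(b, 0)]))"
      using ps(1) box ab by (auto simp: sorted_append)
  qed (use h in \<open>auto simp: list_all2_append list.rel_refl\<close>)
  with 1 2 3 have "2 * (sqrt 5 * c / 2 * (real (card P) - 2 * r)) \<le> h * (b - a)" by linarith
  then show ?thesis by (simp add: r_def algebra_simps)
qed



section \<open>A weak Lebesgue density theorem\<close>

text \<open>A nearly tight cover by non-overlapping intervals must contain one of density above
  \<open>\<theta>\<close>, or else the covered set would be smaller than its own measure.\<close>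

lemma dense_interval:
  fixes A :: "real set"
  assumes A: "A \<in> lmeasurable" "0 < measure lebesgue A" and d: "0 < d" and \<theta>: "\<theta> < 1" "0 < \<theta>"
  obtains u v where "u < v" "v - u < d" "\<theta> * (v - u) < measure lebesgue (A \<inter> {u..v})"
proof -
  \<comment> \<open>Countably many cells cover \<open>A\<close>. Their length \<open>d / 2\<close>
    keeps all later intervals strictly shorter than \<open>d\<close>.\<close>
  obtain j :: int where j: "0 < measure lebesgue (A \<inter> {of_int j * (d / 2)..of_int (j + 1) * (d / 2)})"
  proof (rule ccontr)
    let ?J = "\<lambda>j::int. A \<inter> {of_int j * (d / 2)..of_int (j + 1) * (d / 2)}"
    assume "\<not> thesis"
    then have "measure lebesgue (?J j) = 0" for j
      using that zero_less_measure_iff by blast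
    moreover have meas: "?J j \<in> lmeasurable" for j
      using A by (intro fmeasurable_Int_fmeasurable) auto
    ultimately have "negligible (?J j)" for j
      by (simp add: negligible_iff_measure)
    then have "negligible (\<Union>j. ?J j)" by (intro negligible_countable_Union) auto
    moreover have "A \<subseteq> (\<Union>j. ?J j)"
    proof
      fix x assume "x \<in> A"
      moreover have "of_int \<lfloor>x / (d / 2)\<rfloor> \<le> x / (d / 2)" "x / (d / 2) \<le> of_int (\<lfloor>x / (d / 2)\<rfloor> + 1)"
        by linarith+
      then have "of_int \<lfloor>x / (d / 2)\<rfloor> * (d / 2) \<le> x" "x \<le> of_int (\<lfloor>x / (d / 2)\<rfloor> + 1) * (d / 2)"
        using d by (simp_all only: pos_le_divide_eq pos_divide_le_eq half_gt_zero)
      ultimately show "x \<in> (\<Union>j. ?J j)" by auto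
    qed
    ultimately have "negligible A" by (rule negligible_subset)
    then show False using A by (simp add: negligible_iff_measure)
  qed
  define a where "a = of_int j * (d / 2)"
  define b where "b = of_int (j + 1) * (d / 2)"
  define S where "S = A \<inter> {a..b}"
  have ab: "a < b" "b - a < d" using d by (auto simp: a_def b_def algebra_simps)
  have S: "S \<in> lmeasurable" "0 < measure lebesgue S"
    using A j by (auto simp: S_def a_def b_def intro: fmeasurable_Int_fmeasurable)
  \<comment> \<open>Chosen so that \<open>\<theta> * e\<close> is half of the slack
    \<open>measure lebesgue S * (1 - \<theta>)\<close>.\<close>
  define e where "e = measure lebesgue S * (1 - \<theta>) / (2 * \<theta>)"
  have "0 < e" using S \<theta> by (simp add: e_def)
  obtain \<D> where \<D>: "countable \<D>"
      "\<And>K. K \<in> \<D> \<Longrightarrow> K \<subseteq> cbox a b \<and> K \<noteq> {} \<and> (\<exists>c d. K = cbox c d)"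
      "pairwise (\<lambda>A B. interior A \<inter> interior B = {}) \<D>"
      "\<And>K. \<lbrakk>K \<in> \<D>; box a b \<noteq> {}\<rbrakk> \<Longrightarrow> interior K \<noteq> {}"
      "S \<subseteq> \<Union>\<D>" "\<Union>\<D> \<in> lmeasurable" "measure lebesgue (\<Union>\<D>) \<le> measure lebesgue S + e"
  proof (rule measurable_outer_intervals_bounded)
    show "S \<in> lmeasurable" "0 < e" by fact+
    show "S \<subseteq> cbox a b" by (simp add: S_def)
  qed blast
  have "\<exists>K\<in>\<D>. \<theta> * measure lebesgue K < measure lebesgue (S \<inter> K)"
  proof (rule ccontr)
    assume "\<not> ?thesis"
    then have le: "measure lebesgue (S \<inter> K) \<le> \<theta> * measure lebesgue K" if "K \<in> \<D>" for K
      using that by (auto simp: not_less)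
    have Km: "K \<in> lmeasurable" if "K \<in> \<D>" for K
      using \<D>(2)[OF that] by auto
    have fin: "measure lebesgue (\<Union>K\<in>\<F>. S \<inter> K) \<le> \<theta> * measure lebesgue (\<Union>\<D>)"
      if \<F>: "\<F> \<subseteq> \<D>" "finite \<F>" for \<F>
    proof -
      have "measure lebesgue (\<Union>K\<in>\<F>. S \<inter> K) \<le> (\<Sum>K\<in>\<F>. measure lebesgue (S \<inter> K))"
        using \<F> S Km by (intro measure_UNION_le) (auto intro: fmeasurable_Int_fmeasurable)
      also have "\<dots> \<le> (\<Sum>K\<in>\<F>. \<theta> * measure lebesgue K)"
        using le \<F> by (intro sum_mono) auto
      also have "\<dots> = \<theta> * (\<Sum>K\<in>\<F>. measure lebesgue K)" by (simp add: sum_distrib_left)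
      also have "(\<Sum>K\<in>\<F>. measure lebesgue K) = measure lebesgue (\<Union>\<F>)"
      proof (rule measure_negligible_finite_Union[symmetric])
        show "pairwise (\<lambda>S T. negligible (S \<inter> T)) \<F>"
        proof (rule pairwiseI)
          fix K L assume KL: "K \<in> \<F>" "L \<in> \<F>" "K \<noteq> L"
          then have "interior K \<inter> interior L = {}" using \<D>(3) \<F> by (auto simp: pairwise_def)
          then have "K \<inter> L \<subseteq> frontier K \<union> frontier L"
            using closure_subset by (fastforce simp: frontier_def)
          moreover have "convex K" "convex L" using KL \<D>(2) \<F> by (metis convex_box(1) subsetD)+
          then have "negligible (frontier K \<union> frontier L)"
            by (intro negligible_Un negligible_convex_frontier)
          ultimately show "negligible (K \<inter> L)" using negligible_subset by blast
        qed
      qed (use Km \<F> in auto)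
      also have "\<theta> * measure lebesgue (\<Union>\<F>) \<le> \<theta> * measure lebesgue (\<Union>\<D>)"
        using \<theta> \<F> \<D>(6) Km by (intro mult_left_mono measure_mono_fmeasurable fmeasurableD) auto
      finally show ?thesis .
    qed
    have "measure lebesgue (\<Union>K\<in>\<D>. S \<inter> K) \<le> \<theta> * measure lebesgue (\<Union>\<D>)"
      by (rule measure_UN_bound[OF \<D>(1)]) (use S Km fin in \<open>auto intro: fmeasurable_Int_fmeasurable\<close>)
    moreover have "(\<Union>K\<in>\<D>. S \<inter> K) = S" using \<D>(5) by auto
    ultimately have "measure lebesgue S \<le> \<theta> * measure lebesgue (\<Union>\<D>)" by simp
    also have "\<dots> \<le> \<theta> * (measure lebesgue S + e)"
      using \<D>(7) \<theta> by (intro mult_left_mono) auto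
    also have "\<dots> = measure lebesgue S - measure lebesgue S * (1 - \<theta>) / 2"
      using \<theta> by (simp add: e_def field_simps)
    finally have "measure lebesgue S * (1 - \<theta>) \<le> 0" by linarith
    moreover have "0 < measure lebesgue S * (1 - \<theta>)" using S(2) \<theta> by (intro mult_pos_pos) auto
    ultimately show False by linarith
  qed
  then obtain K where K: "K \<in> \<D>" "\<theta> * measure lebesgue K < measure lebesgue (S \<inter> K)" by blast
  obtain u v where uv: "K = {u..v}" using \<D>(2)[OF K(1)] by auto
  have "K \<subseteq> {a..b}" "interior K \<noteq> {}" using \<D>(2,4)[OF K(1)] ab by auto
  then have "u < v" "a \<le> u" "v \<le> b" by (auto simp: uv)
  moreover have "S \<inter> K = A \<inter> {u..v}" using \<open>K \<subseteq> {a..b}\<close> by (auto simp: S_def uv)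
  ultimately show thesis using that[of u v] K(2) ab by (simp add: uv)
qed

section \<open>Visits of an orbit\<close>

lemma measurable_funpow:
  assumes "T \<in> measurable M M" shows "(T ^^ n) \<in> measurable M M"
  by (induction n) (use assms in \<open>auto intro: measurable_comp simp: id_def\<close>)

lemma measure_preserving_map_funpow:
  assumes "measure_preserving_map M T"
  shows "measure_preserving_map M (T ^^ n)"
proof (induction n)
  case 0
  show ?case
    by (auto simp: measure_preserving_map_def id_def intro!: arg_cong[of _ _ "emeasure M"] dest: sets.sets_into_space)
next
  case (Suc n)
  have T: "T \<in> measurable M M" "\<And>A. A \<in> sets M \<Longrightarrow> emeasure M (T -` A \<inter> space M) = emeasure M A"
    using assms by (auto simp: measure_preserving_map_def)
  have Tn: "(T ^^ n) \<in> measurable M M"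
    "\<And>A. A \<in> sets M \<Longrightarrow> emeasure M ((T ^^ n) -` A \<inter> space M) = emeasure M A"
    using Suc by (auto simp: measure_preserving_map_def)
  show ?case unfolding measure_preserving_map_def
  proof (intro conjI ballI)
    show "(T ^^ Suc n) \<in> measurable M M" by (rule measurable_funpow[OF T(1)])
    fix A assume A: "A \<in> sets M"
    have "(T ^^ Suc n) -` A \<inter> space M = (T ^^ n) -` (T -` A \<inter> space M) \<inter> space M"
      using measurable_space[OF Tn(1)] by auto
    then show "emeasure M ((T ^^ Suc n) -` A \<inter> space M) = emeasure M A"
      using Tn(2)[OF measurable_sets[OF T(1) A]] T(2)[OF A] by simp
  qed
qed

text \<open>By invariance the mean number of visits is \<open>h * measure M B\<close>. The number of
  visits takes finitely many values, so its maximum is attained, and it is at least the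
  mean.\<close>

lemma exists_many_visits:
  assumes T: "measure_preserving_map M T" and M: "emeasure M (space M) = 1" and B: "B \<in> sets M"
  obtains x where "x \<in> space M" "real h * measure M B \<le> card {n. n < h \<and> (T ^^ n) x \<in> B}"
proof -
  define N where "N x = card {n. n < h \<and> (T ^^ n) x \<in> B}" for x
  have N_le: "N x \<le> h" for x
    using card_mono[of "{..<h}" "{n. n < h \<and> (T ^^ n) x \<in> B}"] by (auto simp: N_def)
  define m where "m = Max (N ` space M)"
  have fin: "finite (N ` space M)"
    by (rule finite_subset[of _ "{..h}"]) (use N_le in auto)
  have "space M \<noteq> {}" using M by auto
  then have "m \<in> N ` space M" unfolding m_def by (intro Max_in fin) simp
  then obtain x where x: "x \<in> space M" "N x = m" by blast
  let ?V = "\<lambda>n. (T ^^ n) -` B \<inter> space M"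
  have V: "?V n \<in> sets M" "emeasure M (?V n) = emeasure M B" for n
    using measure_preserving_map_funpow[OF T, of n] B
    by (auto simp: measure_preserving_map_def intro: measurable_sets)
  have "of_nat h * emeasure M B = (\<Sum>n<h. emeasure M (?V n))" by (simp add: V)
  also have "\<dots> = (\<integral>\<^sup>+y. (\<Sum>n<h. indicator (?V n) y) \<partial>M)"
    using V by (subst nn_integral_sum) auto
  also have "\<dots> \<le> (\<integral>\<^sup>+y. of_nat m \<partial>M)"
  proof (rule nn_integral_mono)
    fix y assume y: "y \<in> space M"
    have "(\<Sum>n<h. indicator (?V n) y) = (\<Sum>n<h. if (T ^^ n) y \<in> B then 1 else 0 :: ennreal)"
      using y by (intro sum.cong) (auto simp: indicator_def)
    also have "\<dots> = of_nat (N y)"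
      by (simp add: sum.If_cases N_def Int_def lessThan_def conj_commute)
    also have "N y \<le> m" using fin y by (auto simp: m_def)
    finally show "(\<Sum>n<h. indicator (?V n) y) \<le> (of_nat m :: ennreal)" by simp
  qed
  also have "\<dots> = of_nat m" by (simp add: M)
  finally have le: "of_nat h * emeasure M B \<le> of_nat m" .
  have "emeasure M B \<le> 1" using emeasure_space[of M B] M by simp
  then have "emeasure M B = ennreal (measure M B)"
    by (intro emeasure_eq_ennreal_measure) (auto simp: top_unique)
  then have "ennreal (real h * measure M B) \<le> ennreal (real m)"
    using le by (simp add: ennreal_mult ennreal_of_nat_eq_real_of_nat)
  then have "real h * measure M B \<le> real m" by (simp add: ennreal_le_iff)
  then show thesis using that[of x] x by (simp add: N_def)
qed

section \<open>Slow recurrence and the recurrence rate\<close>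

text \<open>The cutoff \<open>d\<close> makes up for the early times, about which a lower limit says
  nothing. It is harmless between visits to an interval shorter than \<open>d\<close>.\<close>

lemma null_sets_slow_recurrence:
  assumes T: "measure_preserving_map unit_lebesgue T" and c: "1 / sqrt 5 < c" and d: "0 < d"
  shows "{x \<in> {0..<1}. \<forall>n\<ge>1. min (c / real n) d \<le> \<bar>(T ^^ n) x - x\<bar>} \<in> null_sets unit_lebesgue"
    (is "?A \<in> _")
proof -
  have c0: "0 < c" using c by (rule less_trans[rotated]) simp
  have c5: "1 < sqrt 5 * c" using c by (simp add: field_simps)
  have TM: "(T ^^ n) \<in> measurable unit_lebesgue unit_lebesgue" for n
    using measure_preserving_map_funpow[OF T] by (simp add: measure_preserving_map_def)
  have id: "(\<lambda>x. x) \<in> borel_measurable unit_lebesgue"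
    using id_borel_measurable_lebesgue_on by (simp add: id_def)
  define f where "f n x = (T ^^ n) x - x" for n x
  have [measurable]: "f n \<in> borel_measurable unit_lebesgue" for n
    unfolding f_def using measurable_compose[OF TM id] id by (rule borel_measurable_diff)
  have "{x \<in> space unit_lebesgue. \<forall>n\<ge>1. min (c / real n) d \<le> \<bar>f n x\<bar>} \<in> sets unit_lebesgue"
    by measurable
  then have "?A \<in> sets unit_lebesgue" by (simp add: f_def)
  moreover define A where "A = ?A"
  ultimately have A: "A \<in> sets unit_lebesgue" by simp
  have A_sub: "A \<subseteq> {0..<1}" unfolding A_def by blast
  have A_slow: "min (c / real n) d \<le> \<bar>(T ^^ n) x - x\<bar>" if "x \<in> A" "1 \<le> n" for x n
    using that by (simp add: A_def)
  have "X \<in> sets lebesgue" if "X \<in> sets unit_lebesgue" for X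
    using that by (simp add: sets_restrict_space_iff)
  from this[OF A] have Alm: "A \<in> lmeasurable"
    by (rule bounded_set_imp_lmeasurable[rotated]) (rule bounded_subset[OF _ A_sub], simp)
  have "measure lebesgue A = 0"
  proof (rule ccontr)
    assume "measure lebesgue A \<noteq> 0"
    then have pos: "0 < measure lebesgue A" by (simp add: zero_less_measure_iff)
    \<comment> \<open>The hypothesis on \<open>c\<close> leaves room for a density
      \<open>\<theta>\<close> below 1 with \<open>sqrt 5 * c * \<theta> > 1\<close>, which makes
      \<open>gap\<close> strict.\<close>
    have "1 / (sqrt 5 * c) < 1" using c5 by simp
    then obtain \<theta> where "1 / (sqrt 5 * c) < \<theta>" "\<theta> < 1" using dense by blast
    moreover have "0 < 1 / (sqrt 5 * c)" using c0 by simp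
    ultimately have \<theta>: "\<theta> < 1" "0 < \<theta>" "1 / (sqrt 5 * c) < \<theta>" by linarith+
    obtain u v where uv: "u < v" "v - u < d" "\<theta> * (v - u) < measure lebesgue (A \<inter> {u..v})"
      using dense_interval[OF Alm pos d \<theta>(1,2)] by blast
    define B where "B = A \<inter> {u..v}"
    define m where "m = measure lebesgue B"
    have "B = A \<inter> ({u..v} \<inter> {0..<1})" using A_sub by (auto simp: B_def)
    moreover have "{u..v} \<inter> {0..<1} \<in> sets unit_lebesgue"
      by (auto simp: sets_restrict_space_iff)
    ultimately have B: "B \<in> sets unit_lebesgue" using sets.Int[OF A] by simp
    have mB: "measure unit_lebesgue B = m"
      unfolding m_def by (rule measure_restrict_space) (use A_sub in \<open>auto simp: B_def\<close>)
    have gap: "sqrt 5 * c * m - (v - u) > 0"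
    proof -
      have "1 \<le> sqrt 5 * c * \<theta>"
        using \<theta>(3) c0 by (simp add: field_simps)
      then have "v - u \<le> (sqrt 5 * c * \<theta>) * (v - u)"
        using uv(1) mult_right_mono[of 1 "sqrt 5 * c * \<theta>" "v - u"] by simp
      also have "\<dots> = sqrt 5 * c * (\<theta> * (v - u))" by simp
      also have "\<dots> < sqrt 5 * c * m"
        using uv(3) c0 by (intro mult_strict_left_mono) (auto simp: m_def B_def)
      finally show ?thesis by simp
    qed
    define K where "K = (v - u + 1) / (2 * sqrt c)"
    have K: "0 \<le> K" using uv c0 by (simp add: K_def)
    have bound: "real h * (sqrt 5 * c * m) \<le> real h * (v - u) + 2 * (sqrt 5 * c) * (1 + K * sqrt h)"
      if h: "1 \<le> h" for h :: nat
    proof -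
      have "emeasure unit_lebesgue (space unit_lebesgue) = 1"
        by (simp add: emeasure_restrict_space)
      then obtain x where x: "real h * m \<le> card {n. n < h \<and> (T ^^ n) x \<in> B}"
        using exists_many_visits[OF T _ B, of h] mB by metis
      define N where "N = {n. n < h \<and> (T ^^ n) x \<in> B}"
      define P where "P = (\<lambda>n. ((T ^^ n) x, real n)) ` N"
      have "finite N" by (simp add: N_def)
      then have P: "finite P" "card P = card N"
        by (auto simp: P_def card_image inj_on_def)
      have sep: "c \<le> \<bar>(T ^^ l) x - (T ^^ k) x\<bar> * (real l - real k)" if kl: "k \<in> N" "l \<in> N" "k < l" for k l
      proof -
        \<comment> \<open>The visit at time \<open>k\<close> is itself a point of \<open>A\<close>,
          so slow recurrence applies to it with return time \<open>l - k\<close>.\<close>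
        have "(T ^^ l) x = (T ^^ (l - k)) ((T ^^ k) x)"
          using kl(3) by (metis add.commute comp_apply funpow_add le_add_diff_inverse less_imp_le)
        moreover have "min (c / real (l - k)) d \<le> \<bar>(T ^^ (l - k)) ((T ^^ k) x) - (T ^^ k) x\<bar>"
          using kl by (intro A_slow) (auto simp: N_def B_def)
        ultimately have "min (c / real (l - k)) d \<le> \<bar>(T ^^ l) x - (T ^^ k) x\<bar>" by simp
        moreover have "\<bar>(T ^^ l) x - (T ^^ k) x\<bar> \<le> v - u"
          using kl by (auto simp: N_def B_def)
        ultimately have "c / real (l - k) \<le> \<bar>(T ^^ l) x - (T ^^ k) x\<bar>" using uv(2) by linarith
        then show ?thesis using kl(3) by (simp add: pos_divide_le_eq of_nat_diff)
      qed
      have "separated c P"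
        unfolding separated_def P_def
      proof (intro ballI impI; elim imageE)
        fix p q k l
        assume pq: "p \<noteq> q" "p = ((T ^^ k) x, real k)" "q = ((T ^^ l) x, real l)" and kl: "k \<in> N" "l \<in> N"
        have "k < l \<or> l < k" using pq by (metis linorder_neqE_nat)
        then show "c \<le> \<bar>fst p - fst q\<bar> * \<bar>snd p - snd q\<bar>"
        proof
          assume "k < l"
          then show ?thesis using sep[OF kl] pq by (simp add: abs_minus_commute)
        next
          assume "l < k"
          then show ?thesis using sep[OF kl(2,1)] pq by simp
        qed
      qed
      moreover have "P \<subseteq> {u..v} \<times> {0..real h}"
        by (auto simp: P_def N_def B_def)
      ultimately have "sqrt 5 * c * card P
          \<le> real h * (v - u) + 2 * (sqrt 5 * c) * (1 + (v - u + 1) * sqrt h / (2 * sqrt c))"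
        using P(1) c0 h uv(1) by (intro separated_card_le) auto
      moreover have "sqrt 5 * c * (real h * m) \<le> sqrt 5 * c * card P"
        using x c0 P(2) by (intro mult_left_mono) (auto simp: N_def)
      ultimately show ?thesis by (simp add: K_def mult_ac)
    qed
    define D where "D = sqrt 5 * c * m - (v - u)"
    define E where "E = 2 * (sqrt 5 * c) * (1 + K)"
    \<comment> \<open>Taking \<open>h = k ^ 2\<close> makes \<open>sqrt h\<close> equal to
      \<open>k\<close>, and one factor \<open>k\<close> cancels.\<close>
    have "real k * D \<le> E" if k: "1 \<le> k" for k :: nat
    proof -
      have "real k * (real k * D) \<le> 2 * (sqrt 5 * c) * (1 + K * real k)"
        using bound[of "k ^ 2"] k by (simp add: D_def power2_eq_square real_sqrt_mult algebra_simps)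
      also have "\<dots> \<le> 2 * (sqrt 5 * c) * (real k * (1 + K))"
        using k K c0 by (intro mult_left_mono) (auto simp: algebra_simps)
      finally have "real k * (real k * D) \<le> real k * E" by (simp add: E_def mult_ac)
      then show ?thesis using k by (simp add: mult_le_cancel_left)
    qed
    moreover obtain k :: nat where "E < real k * D"
      using reals_Archimedean3[of D] gap by (auto simp: D_def)
    \<comment> \<open>Rules out \<open>k = 0\<close>.\<close>
    moreover have "0 \<le> E" using c0 K by (simp add: E_def)
    ultimately show False
      by (metis leD less_one linorder_not_le mult_zero_left of_nat_0)
  qed
  then have "A \<in> null_sets lebesgue"
    using Alm by (simp add: negligible_iff_measure flip: negligible_iff_null_sets)
  then show ?thesis
    using A_sub unfolding A_def[symmetric] by (simp add: null_sets_restrict_space)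
qed

text \<open>Countably many pairs of \<open>c\<close> decreasing to \<open>1 / sqrt 5\<close> and
  \<open>d\<close> decreasing to 0 suffice: a point with larger recurrence rate lies in one of the
  null sets.\<close>

theorem theorem2:
  fixes T :: "real \<Rightarrow> real"
  assumes "measure_preserving_map unit_lebesgue T"
  shows "AE x in unit_lebesgue. recurrence_rate T x \<le> ereal (1 / sqrt 5)"
proof -
  define A where "A c d = {x \<in> {0..<1}. \<forall>n\<ge>1. min (c / real n) d \<le> \<bar>(T ^^ n) x - x\<bar>}" for c d
  define cs where "cs i = 1 / sqrt 5 + inverse (real (Suc i))" for i
  have "A (cs i) (inverse (real (Suc j))) \<in> null_sets unit_lebesgue" for i j
    unfolding A_def using assms by (rule null_sets_slow_recurrence) (simp_all add: cs_def)
  then have "AE x in unit_lebesgue. \<forall>i j. x \<notin> A (cs i) (inverse (real (Suc j)))"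
    by (simp add: AE_all_countable AE_not_in)
  then show ?thesis
  proof (rule AE_mp, intro AE_I2 impI)
    fix x
    assume x: "x \<in> space unit_lebesgue" and notA: "\<forall>i j. x \<notin> A (cs i) (inverse (real (Suc j)))"
    show "recurrence_rate T x \<le> ereal (1 / sqrt 5)"
    proof (rule ccontr)
      assume "\<not> ?thesis"
      then obtain c where c: "ereal (1 / sqrt 5) < ereal c" "ereal c < recurrence_rate T x"
        using ereal_dense2 by (metis not_le)
      then obtain N where N: "c < real n * \<bar>(T ^^ n) x - x\<bar>" if "N \<le> n" for n
        using less_LiminfD[OF c(2)[unfolded recurrence_rate_def]]
        unfolding eventually_sequentially by auto
      have c0: "0 < c" using c(1) by (auto intro: less_trans[rotated])
      \<comment> \<open>A periodic point returns exactly at arbitrarily large times, against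
        \<open>N\<close>. So the finitely many early distances have a positive minimum.\<close>
      have not_periodic: "(T ^^ n) x \<noteq> x" if "1 \<le> n" for n
      proof
        assume "(T ^^ n) x = x"
        then have "(T ^^ (n * N)) x = x"
          by (induction N) (simp_all add: funpow_add)
        moreover have "N \<le> n * N" using that by simp
        ultimately show False using N[of "n * N"] c0 by simp
      qed
      \<comment> \<open>The element 1 covers the case that there are no early times.\<close>
      define e where "e = Min (insert 1 ((\<lambda>n. \<bar>(T ^^ n) x - x\<bar>) ` {1..<N}))"
      have "0 < e" using not_periodic by (auto simp: e_def)
      then obtain j where j: "inverse (real (Suc j)) < e" using reals_Archimedean by blast
      have "0 < c - 1 / sqrt 5" using c(1) by simp
      then obtain i where i: "inverse (real (Suc i)) < c - 1 / sqrt 5" using reals_Archimedean by blast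
      have "x \<in> A (cs i) (inverse (real (Suc j)))"
        unfolding A_def
      proof (intro CollectI conjI allI impI)
        show "x \<in> {0..<1}" using x by simp
        fix n :: nat assume n: "1 \<le> n"
        show "min (cs i / real n) (inverse (real (Suc j))) \<le> \<bar>(T ^^ n) x - x\<bar>"
        proof (cases "N \<le> n")
          case True
          then have "cs i < \<bar>(T ^^ n) x - x\<bar> * real n"
            using N[OF True] i by (simp add: cs_def mult.commute)
          then have "cs i / real n \<le> \<bar>(T ^^ n) x - x\<bar>" using n by (simp add: pos_divide_le_eq)
          then show ?thesis by linarith
        next
          case False
          then have "e \<le> \<bar>(T ^^ n) x - x\<bar>" using n unfolding e_def by (intro Min_le) auto
          then show ?thesis using j by linarith
        qed
      qed
      then show False using notA by blast
    qed
  qed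
qed

end
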